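(* For a Lagrange relative equilibrium of masses $m_1,m_2,m_3>0$ with arc angles $\sigma_{12},\sigma_{23},\sigma_{31}$, the angular velocity $\omega$ is given by $$\omega^2=U'(\cos\sigma_{12})\,U'(\cos\sigma_{23})\,U'(\cos\sigma_{31})\left(\sum_{(i,j,k)}\frac{m_k}{(U'(\cos\sigma_{ij}))^2}\right),$$ where the sum runs over $(i,j,k)\in\{(1,2,3),(2,3,1),(3,1,2)\}$.
   Context: Three point particles with masses $m_k>0$ move on the unit sphere $\mathbb{S}^2\subset\mathbb{R}^3$ at positions $q_k$, with arc angles $\sigma_{ij}=\sigma_{ji}\in(0,\pi)$, $\cos\sigma_{ij}=q_i\cdot q_j$. The motion is governed by the Euler–Lagrange equations on $(\mathbb{S}^2)^3$ of $L=\sum_k\frac{m_k}{2}|\dot q_k|^2+\sum_{i<j}m_im_jU(q_i\cdot q_j)$, where $U:(-1,1)\to\mathbb{R}$ is differentiable with derivative $U'$ (with respect to its argument) continuous, nowhere zero, of constant sign. A relative equilibrium is a solution with $\dot q_k=\Omega\times q_k$ for all $k$, $\Omega\in\mathbb{R}^3$ constant; $\omega=|\Omega|$. It is a Lagrange relative equilibrium if the three bodies are not on a common great circle. *)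

theory Defs
  imports "HOL-Analysis.Analysis"
begin

text \<open>A state of the three bodies is an element of \<open>real^3^3\<close>: component \<open>k :: 3\<close> belongs to body \<open>k\<close>.
  In the type \<open>3\<close> the numeral \<open>3\<close> denotes the same element as \<open>0\<close>, so its elements are \<open>1\<close>, \<open>2\<close>, \<open>3\<close>.\<close>

text \<open>The Lagrangian, written in the ambient space. Only its values for \<open>q\<close> in \<open>configs\<close> are
  meaningful, since \<open>U\<close> is only given on the open interval from \<open>-1\<close> to \<open>1\<close>.\<close>

definition lagrangian :: "(real \<Rightarrow> real) \<Rightarrow> (3 \<Rightarrow> real) \<Rightarrow> real^3^3 \<Rightarrow> real^3^3 \<Rightarrow> real" where
  "lagrangian U m q v =
     (\<Sum>k\<in>UNIV. m k / 2 * (norm (v $ k))\<^sup>2) +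
     (\<Sum>(i, j)\<in>{(1, 2), (1, 3), (2, 3)}. m i * m j * U (q $ i \<bullet> q $ j))"

text \<open>Unit vectors have an arc angle strictly between \<open>0\<close> and \<open>pi\<close> iff their inner product is
  strictly between \<open>-1\<close> and \<open>1\<close>.\<close>

definition configs :: "(real^3^3) set" where
  "configs = {q. (\<forall>k. q $ k \<in> sphere 0 1) \<and> (\<forall>i j. i \<noteq> j \<longrightarrow> q $ i \<bullet> q $ j \<in> {-1<..<1})}"

text \<open>The tangent space at \<open>q\<close> of the product of three unit spheres.\<close>

definition tangent_space :: "real^3^3 \<Rightarrow> (real^3^3) set" where
  "tangent_space q = {w. \<forall>k. q $ k \<bullet> w $ k = 0}"

text \<open>The Euler--Lagrange equations on a submanifold with tangent spaces \<open>T x\<close>: the covector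
  \<open>d/dt (dL/dv) - dL/dx\<close> along the curve annihilates the tangent vectors. Here \<open>p\<close> and \<open>f\<close> are the
  gradients of \<open>L\<close> in the velocity and in the position, taken in the ambient space; the condition
  does not depend on how \<open>L\<close> is extended off the submanifold.\<close>

definition euler_lagrange_on ::
    "('a::real_inner \<Rightarrow> 'a set) \<Rightarrow> ('a \<Rightarrow> 'a \<Rightarrow> real) \<Rightarrow> (real \<Rightarrow> 'a) \<Rightarrow> bool" where
  "euler_lagrange_on T L q \<longleftrightarrow>
     (\<exists>v p p' f. \<forall>t.
        (q has_vector_derivative v t) (at t) \<and>
        GDERIV (\<lambda>w. L (q t) w) (v t) :> p t \<and>
        (p has_vector_derivative p' t) (at t) \<and>
        GDERIV (\<lambda>x. L x (v t)) (q t) :> f t \<and>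
        (\<forall>w\<in>T (q t). (p' t - f t) \<bullet> w = 0))"

definition is_motion :: "(real \<Rightarrow> real) \<Rightarrow> (3 \<Rightarrow> real) \<Rightarrow> (real \<Rightarrow> real^3^3) \<Rightarrow> bool" where
  "is_motion U m q \<longleftrightarrow>
     (\<forall>t. q t \<in> configs) \<and> euler_lagrange_on tangent_space (lagrangian U m) q"

definition relative_equilibrium ::
    "(real \<Rightarrow> real) \<Rightarrow> (3 \<Rightarrow> real) \<Rightarrow> real^3 \<Rightarrow> (real \<Rightarrow> real^3^3) \<Rightarrow> bool" where
  "relative_equilibrium U m \<Omega> q \<longleftrightarrow>
     is_motion U m q \<and>
     (\<forall>k t. ((\<lambda>s. q s $ k) has_vector_derivative cross3 \<Omega> (q t $ k)) (at t))"

definition great_circle :: "(real^3) set \<Rightarrow> bool" where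
  "great_circle C \<longleftrightarrow> (\<exists>n. n \<noteq> 0 \<and> C = {x \<in> sphere 0 1. n \<bullet> x = 0})"

definition lagrange_relative_equilibrium ::
    "(real \<Rightarrow> real) \<Rightarrow> (3 \<Rightarrow> real) \<Rightarrow> real^3 \<Rightarrow> (real \<Rightarrow> real^3^3) \<Rightarrow> bool" where
  "lagrange_relative_equilibrium U m \<Omega> q \<longleftrightarrow>
     relative_equilibrium U m \<Omega> q \<and>
     (\<forall>t. \<nexists>C. great_circle C \<and> (\<forall>k. q t $ k \<in> C))"

definition arc_angles :: "real^3^3 \<Rightarrow> (3 \<Rightarrow> 3 \<Rightarrow> real) \<Rightarrow> bool" where
  "arc_angles x \<sigma> \<longleftrightarrow>
     (\<forall>i j. i \<noteq> j \<longrightarrow> \<sigma> i j = \<sigma> j i \<and> \<sigma> i j \<in> {0<..<pi} \<and> cos (\<sigma> i j) = x $ i \<bullet> x $ j)"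

end

theory Submission imports Defs begin

text \<open>The Euler--Lagrange equations at a single instant, tested against a variation \<open>a\<close> of one
  body with \<open>a\<close> orthogonal to \<open>q\<^sub>k\<close>, read
  \<open>(\<Omega> \<bullet> q\<^sub>k) (\<Omega> \<bullet> a) = (\<Sum>j\<noteq>k. m\<^sub>j U'(q\<^sub>k \<bullet> q\<^sub>j) (q\<^sub>j \<bullet> a))\<close>.
  Choosing \<open>a = q\<^sub>k \<times> q\<^sub>i\<close> isolates a single \<open>j\<close>: with \<open>s\<^sub>k = \<Omega> \<bullet> q\<^sub>k\<close>, with \<open>d\<^sub>j\<close> the triple product
  of \<open>\<Omega>\<close> and the two bodies other than \<open>j\<close>, and with \<open>D = det (q\<^sub>1, q\<^sub>2, q\<^sub>3)\<close>, it gives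
  \<open>s\<^sub>k d\<^sub>j = m\<^sub>j U'(q\<^sub>k \<bullet> q\<^sub>j) D\<close>. By Cramer's rule \<open>D \<Omega> = (\<Sum>j. d\<^sub>j q\<^sub>j)\<close>, hence
  \<open>D \<bar>\<Omega>\<bar>\<^sup>2 = (\<Sum>j. d\<^sub>j s\<^sub>j)\<close>, and the six relations determine the products \<open>d\<^sub>j s\<^sub>j\<close>.\<close>

lemma lagrangian_gderiv_velocity:
  "GDERIV (lagrangian U m q) v :> (\<chi> k. m k *\<^sub>R v $ k)"
proof -
  \<comment> \<open>The norm is not differentiable at the zero vector; the inner product is
    differentiable everywhere, so no case \<open>v $ k = 0\<close> arises.\<close>
  have eq: "lagrangian U m q = (\<lambda>v. (\<Sum>k\<in>UNIV. m k / 2 * (v $ k \<bullet> v $ k)) +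
     (\<Sum>(i, j)\<in>{(1, 2), (1, 3), (2, 3)}. m i * m j * U (q $ i \<bullet> q $ j)))"
    by (simp add: lagrangian_def fun_eq_iff power2_norm_eq_inner)
  have nth: "((\<lambda>v. v $ k) has_derivative (\<lambda>h. h $ k)) (at v)" for k
    by (intro bounded_linear.has_derivative[OF bounded_linear_vec_nth] has_derivative_ident)
  show ?thesis
    unfolding eq gderiv_def
    by (rule derivative_eq_intros nth refl)+
      (simp add: fun_eq_iff inner_vec_def inner_commute sum_distrib_left field_simps)
qed

text \<open>Membership in \<open>configs\<close> keeps each inner product where \<open>U\<close> is
  differentiable, so the chain rule applies. The derivative is left as a linear map because it is
  only evaluated at a variation; no closed form of the gradient is required.\<close>

lemma lagrangian_has_derivative_position:
  fixes x v :: "real^3^3"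
  assumes U: "\<forall>y\<in>{-1<..<1}. (U has_real_derivative U' y) (at y)"
    and x: "x \<in> configs"
  shows "((\<lambda>x. lagrangian U m x v) has_derivative
    (\<lambda>h. \<Sum>(i, j)\<in>{(1, 2), (1, 3), (2, 3)}.
      m i * m j * (U' (x $ i \<bullet> x $ j) * (x $ i \<bullet> h $ j + h $ i \<bullet> x $ j)))) (at x)"
proof -
  have nth: "((\<lambda>x. x $ k) has_derivative (\<lambda>h. h $ k)) (at x)" for k
    by (intro bounded_linear.has_derivative[OF bounded_linear_vec_nth] has_derivative_ident)
  have ij: "((\<lambda>x. U (x $ i \<bullet> x $ j)) has_derivative
      (\<lambda>h. U' (x $ i \<bullet> x $ j) * (x $ i \<bullet> h $ j + h $ i \<bullet> x $ j))) (at x)"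
    if "i \<noteq> j" for i j :: 3
  proof -
    have "x $ i \<bullet> x $ j \<in> {-1<..<1}"
      using x that by (auto simp: configs_def)
    with U have "(U has_derivative (*) (U' (x $ i \<bullet> x $ j))) (at (x $ i \<bullet> x $ j))"
      by (simp add: has_field_derivative_def)
    from has_derivative_compose[OF has_derivative_inner[OF nth nth] this] show ?thesis .
  qed
  have "((\<lambda>x. \<Sum>(i, j)\<in>{(1, 2), (1, 3), (2, 3)}. m i * m j * U (x $ i \<bullet> x $ j)) has_derivative
    (\<lambda>h. \<Sum>(i, j)\<in>{(1, 2), (1, 3), (2, 3)}.
      m i * m j * (U' (x $ i \<bullet> x $ j) * (x $ i \<bullet> h $ j + h $ i \<bullet> x $ j)))) (at x)"
    by (rule has_derivative_sum) (auto intro!: has_derivative_mult_right ij)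
  from has_derivative_add[OF has_derivative_const this] show ?thesis
    by (simp only: lagrangian_def add_0)
qed

text \<open>The velocity, momentum and gradients in \<open>euler_lagrange_on\<close> are only
  asserted to exist. Uniqueness of derivatives identifies each of them, and rigid rotation turns
  every time derivative into an application of \<open>cross3 \<Omega>\<close>.\<close>

lemma relative_equilibrium_variation:
  fixes w :: "real^3^3"
  assumes U: "\<forall>y\<in>{-1<..<1}. (U has_real_derivative U' y) (at y)"
    and re: "relative_equilibrium U m \<Omega> q"
    and w: "w \<in> tangent_space (q t)"
  shows "(\<Sum>k\<in>UNIV. m k * (cross3 \<Omega> (cross3 \<Omega> (q t $ k)) \<bullet> w $ k)) =
    (\<Sum>(i, j)\<in>{(1, 2), (1, 3), (2, 3)}.
      m i * m j * (U' (q t $ i \<bullet> q t $ j) * (q t $ i \<bullet> w $ j + w $ i \<bullet> q t $ j)))"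
proof -
  from re have conf: "q t \<in> configs"
    and vel: "\<And>k t. ((\<lambda>s. q s $ k) has_vector_derivative cross3 \<Omega> (q t $ k)) (at t)"
    and EL: "euler_lagrange_on tangent_space (lagrangian U m) q"
    by (auto simp: relative_equilibrium_def is_motion_def)
  from EL obtain v p p' f where
    v: "\<And>t. (q has_vector_derivative v t) (at t)"
    and p: "\<And>t. GDERIV (\<lambda>w. lagrangian U m (q t) w) (v t) :> p t"
    and p': "\<And>t. (p has_vector_derivative p' t) (at t)"
    and f: "\<And>t. GDERIV (\<lambda>x. lagrangian U m x (v t)) (q t) :> f t"
    and zero: "\<And>t w. w \<in> tangent_space (q t) \<Longrightarrow> (p' t - f t) \<bullet> w = 0"
    unfolding euler_lagrange_on_def by metis
  have v_eq: "v s $ k = cross3 \<Omega> (q s $ k)" for s k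
    using bounded_linear.has_vector_derivative[OF bounded_linear_vec_nth v] vel
    by (rule vector_derivative_unique_at)
  have p_eq: "p s = (\<chi> k. m k *\<^sub>R cross3 \<Omega> (q s $ k))" for s
  proof -
    have "(\<lambda>h. h \<bullet> p s) = (\<lambda>h. h \<bullet> (\<chi> k. m k *\<^sub>R v s $ k))"
      using p[of s] lagrangian_gderiv_velocity[of U m "q s" "v s"]
      unfolding gderiv_def by (rule has_derivative_unique)
    then show ?thesis
      by (metis (no_types, lifting) v_eq vec_lambda_unique vector_eq_ldot)
  qed
  have p'_eq: "p' t $ k = m k *\<^sub>R cross3 \<Omega> (cross3 \<Omega> (q t $ k))" for k
  proof -
    have "((\<lambda>s. p s $ k) has_vector_derivative p' t $ k) (at t)"
      by (rule bounded_linear.has_vector_derivative[OF bounded_linear_vec_nth p'])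
    \<comment> \<open>The momentum of body \<open>k\<close> is a fixed linear image of its position,
      so its derivative is the same image of the velocity.\<close>
    moreover have "bounded_linear (\<lambda>x. m k *\<^sub>R cross3 \<Omega> x)"
      by (rule linear_conv_bounded_linear[THEN iffD1])
        (auto intro!: linearI simp: cross_add_right cross_mult_right algebra_simps)
    from bounded_linear.has_vector_derivative[OF this vel]
    have "((\<lambda>s. p s $ k) has_vector_derivative m k *\<^sub>R cross3 \<Omega> (cross3 \<Omega> (q t $ k))) (at t)"
      by (simp add: p_eq)
    ultimately show ?thesis
      by (rule vector_derivative_unique_at)
  qed
  have "(\<lambda>h. h \<bullet> f t) = (\<lambda>h. \<Sum>(i, j)\<in>{(1, 2), (1, 3), (2, 3)}.
      m i * m j * (U' (q t $ i \<bullet> q t $ j) * (q t $ i \<bullet> h $ j + h $ i \<bullet> q t $ j)))"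
    using f[of t, unfolded gderiv_def] lagrangian_has_derivative_position[OF U conf]
    by (rule has_derivative_unique)
  then have "w \<bullet> f t = (\<Sum>(i, j)\<in>{(1, 2), (1, 3), (2, 3)}.
      m i * m j * (U' (q t $ i \<bullet> q t $ j) * (q t $ i \<bullet> w $ j + w $ i \<bullet> q t $ j)))"
    by (rule fun_cong)
  moreover have "p' t \<bullet> w = (\<Sum>k\<in>UNIV. m k * (cross3 \<Omega> (cross3 \<Omega> (q t $ k)) \<bullet> w $ k))"
    by (simp add: inner_vec_def[of "p' t"] p'_eq)
  moreover have "p' t \<bullet> w = w \<bullet> f t"
    using zero[OF w] by (simp add: inner_diff_right inner_commute)
  ultimately show ?thesis
    by simp
qed

text \<open>The variation \<open>axis k a\<close> moves body \<open>k\<close> alone, so a common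
  factor \<open>m k\<close> cancels. In the double cross product the component along
  \<open>q t $ k\<close> vanishes against \<open>a\<close>.\<close>

lemma relative_equilibrium_body:
  fixes a :: "real^3" and i j k :: 3
  assumes U: "\<forall>y\<in>{-1<..<1}. (U has_real_derivative U' y) (at y)"
    and re: "relative_equilibrium U m \<Omega> q"
    and pos: "m k > 0"
    and a: "q t $ k \<bullet> a = 0"
    and ijk: "i \<noteq> j" "j \<noteq> k" "k \<noteq> i"
  shows "(\<Omega> \<bullet> q t $ k) * (\<Omega> \<bullet> a) =
    m i * U' (q t $ k \<bullet> q t $ i) * (q t $ i \<bullet> a) + m j * U' (q t $ k \<bullet> q t $ j) * (q t $ j \<bullet> a)"
proof -
  have t: "axis k a \<in> tangent_space (q t)"
    using a by (auto simp: tangent_space_def axis_def)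
  have "cross3 \<Omega> (cross3 \<Omega> (q t $ k)) \<bullet> a = (\<Omega> \<bullet> q t $ k) * (\<Omega> \<bullet> a)"
    using a by (simp add: Lagrange inner_diff_left)
  then have "m k * ((\<Omega> \<bullet> q t $ k) * (\<Omega> \<bullet> a)) =
      (\<Sum>l\<in>UNIV. m l * (cross3 \<Omega> (cross3 \<Omega> (q t $ l)) \<bullet> axis k a $ l))"
    by (simp add: axis_def if_distrib cong: if_cong)
  also have "\<dots> = m k * (m i * U' (q t $ k \<bullet> q t $ i) * (q t $ i \<bullet> a) +
      m j * U' (q t $ k \<bullet> q t $ j) * (q t $ j \<bullet> a))"
    unfolding relative_equilibrium_variation[OF U re t]
    using ijk exhaust_3[of i] exhaust_3[of j] exhaust_3[of k]
    by (auto simp: axis_def inner_commute algebra_simps)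
  finally show ?thesis
    using pos by simp
qed

text \<open>A nonzero kernel vector of the matrix with rows \<open>x $ k\<close> is normal to a
  plane through the origin containing all three points.\<close>

lemma det_eq_0_imp_great_circle:
  fixes x :: "real^3^3"
  assumes "det x = 0" and "\<And>k. norm (x $ k) = 1"
  shows "\<exists>C. great_circle C \<and> (\<forall>k. x $ k \<in> C)"
proof -
  from assms(1) obtain n where n: "n \<noteq> 0" "x *v n = 0"
    by (metis invertible_det_nz invertible_left_inverse matrix_left_invertible_ker)
  have "n \<bullet> x $ k = 0" for k
    using n(2) by (metis inner_commute matrix_vector_mul_component zero_index)
  with n(1) assms(2) show ?thesis
    by (intro exI[of _ "{y \<in> sphere 0 1. n \<bullet> y = 0}"]) (auto simp: great_circle_def)
qed

lemma cramer_inner_3: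
  fixes \<Omega> :: "real^3" and x :: "real^3^3"
  shows "det x * (\<Omega> \<bullet> \<Omega>) =
    (\<Omega> \<bullet> cross3 (x $ 2) (x $ 3)) * (\<Omega> \<bullet> x $ 1) +
    (\<Omega> \<bullet> cross3 (x $ 3) (x $ 1)) * (\<Omega> \<bullet> x $ 2) +
    (\<Omega> \<bullet> cross3 (x $ 1) (x $ 2)) * (\<Omega> \<bullet> x $ 3)"
  by (simp add: det_3 cross3_def inner_vec_def sum_3 algebra_simps)

text \<open>Pure algebra: \<open>a\<close>, \<open>b\<close>, \<open>c\<close> stand for
  \<open>U'\<close> at the pairs 12, 23, 31, and \<open>W\<close> for the squared norm of
  \<open>\<Omega>\<close>. The relations give only products with distinct indices, whereas
  \<open>W\<close> needs those with equal indices.\<close>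

lemma squared_norm_from_relations:
  fixes D W s1 s2 s3 d1 d2 d3 m1 m2 m3 a b c :: real
  assumes nz: "D \<noteq> 0" "m1 \<noteq> 0" "m2 \<noteq> 0" "m3 \<noteq> 0" "a \<noteq> 0" "b \<noteq> 0" "c \<noteq> 0"
    and W: "D * W = d1 * s1 + d2 * s2 + d3 * s3"
    and e: "s1 * d2 = m2 * a * D" "s2 * d1 = m1 * a * D"
      "s2 * d3 = m3 * b * D" "s3 * d2 = m2 * b * D"
      "s3 * d1 = m1 * c * D" "s1 * d3 = m3 * c * D"
  shows "W = a * b * c * (m3 / a\<^sup>2 + m1 / b\<^sup>2 + m2 / c\<^sup>2)"
proof -
  \<comment> \<open>The products of \<open>x\<close>, \<open>z\<close> with \<open>y\<close>,
    \<open>y'\<close> form a rank-one table, \<open>(x * y') * (z * y) = (x * y) * (z * y')\<close>,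
    so three entries determine the fourth.\<close>
  have ratio: "z * y = n * (v * w / u) * D"
    if "x * y' = m' * u * D" "z * y' = m' * v * D" "x * y = n * w * D" "m' \<noteq> 0" "u \<noteq> 0"
    for x y y' z m' n u v w :: real
  proof -
    have "(u * m' * D) * (z * y) = (x * y) * (z * y')"
      using that(1) by (simp add: ac_simps)
    also have "\<dots> = (u * m' * D) * (n * (v * w / u) * D)"
      using that by (simp add: ac_simps)
    finally have "(u * m' * D) * (z * y) = (u * m' * D) * (n * (v * w / u) * D)" .
    moreover have "u * m' * D \<noteq> 0"
      using that nz by simp
    ultimately show ?thesis
      by (metis mult_left_cancel)
  qed
  have "d3 * s3 = m3 * (b * c / a) * D" "d1 * s1 = m1 * (a * c / b) * D" "d2 * s2 = m2 * (a * b / c) * D"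
    using ratio[OF e(1) e(4) e(6)] ratio[OF e(3) e(6) e(2)] ratio[OF e(5) e(2) e(4)] nz
    by (simp_all add: mult.commute)
  with W have "D * W = D * (m3 * (b * c / a) + m1 * (a * c / b) + m2 * (a * b / c))"
    by (simp add: algebra_simps)
  with nz have "W = m3 * (b * c / a) + m1 * (a * c / b) + m2 * (a * b / c)"
    by simp
  also have "\<dots> = a * b * c * (m3 / a\<^sup>2 + m1 / b\<^sup>2 + m2 / c\<^sup>2)"
    using nz by (simp add: field_simps power2_eq_square)
  finally show ?thesis .
qed

theorem corollary4:
  fixes U U' :: "real \<Rightarrow> real" and m :: "3 \<Rightarrow> real" and \<Omega> :: "real^3"
    and q :: "real \<Rightarrow> real^3^3" and t :: real and \<sigma> :: "3 \<Rightarrow> 3 \<Rightarrow> real"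
  assumes "\<And>x. x \<in> {-1<..<1} \<Longrightarrow> (U has_real_derivative U' x) (at x)"
    and "continuous_on {-1<..<1} U'"
    and "(\<forall>x\<in>{-1<..<1}. U' x > 0) \<or> (\<forall>x\<in>{-1<..<1}. U' x < 0)"
    and "\<And>k. m k > 0"
    and "lagrange_relative_equilibrium U m \<Omega> q"
    and "arc_angles (q t) \<sigma>"
  shows "(norm \<Omega>)\<^sup>2 =
    U' (cos (\<sigma> 1 2)) * U' (cos (\<sigma> 2 3)) * U' (cos (\<sigma> 3 1)) *
    (\<Sum>(i, j, k)\<in>{(1, 2, 3), (2, 3, 1), (3, 1, 2)}. m k / (U' (cos (\<sigma> i j)))\<^sup>2)"
proof -
  define x where "x = q t"
  from assms(5) have re: "relative_equilibrium U m \<Omega> q"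
    by (simp add: lagrange_relative_equilibrium_def)
  then have conf: "x \<in> configs"
    by (simp add: relative_equilibrium_def is_motion_def x_def)
  then have unit: "norm (x $ k) = 1" for k
    by (simp add: configs_def)
  have U'_nz: "U' (x $ i \<bullet> x $ j) \<noteq> 0" if "i \<noteq> j" for i j
  proof -
    have "x $ i \<bullet> x $ j \<in> {-1<..<1}"
      using conf that by (simp add: configs_def)
    with assms(3) show ?thesis
      by (metis less_irrefl)
  qed
  have cos_eq: "cos (\<sigma> i j) = x $ i \<bullet> x $ j" if "i \<noteq> j" for i j
    using assms(6) that by (simp add: arc_angles_def x_def)
  \<comment> \<open>This is where the Lagrange condition enters, at the instant
    \<open>t\<close>.\<close>
  have det: "det x \<noteq> 0"
    using det_eq_0_imp_great_circle[OF _ unit] assms(5)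
    by (auto simp only: lagrange_relative_equilibrium_def x_def)
  have "\<forall>y\<in>{-1<..<1}. (U has_real_derivative U' y) (at y)"
    using assms(1) by blast
  note body = relative_equilibrium_body[OF this re assms(4), where t = t, folded x_def]
  have det_eq: "x $ 1 \<bullet> cross3 (x $ 2) (x $ 3) = det x"
    "x $ 2 \<bullet> cross3 (x $ 3) (x $ 1) = det x"
    "x $ 3 \<bullet> cross3 (x $ 1) (x $ 2) = det x"
    by (simp_all add: det_3 cross3_def inner_vec_def sum_3 algebra_simps)
  \<comment> \<open>Below, \<open>a\<close> is the cross product of bodies \<open>k\<close> and
    \<open>i\<close>, taken in cyclic order so that its inner product with body \<open>j\<close> is
    \<open>det x\<close> without a sign.\<close>
  have e: "(\<Omega> \<bullet> x $ k) * (\<Omega> \<bullet> a) = m j * U' (x $ k \<bullet> x $ j) * det x"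
    if "i \<noteq> j" "j \<noteq> k" "k \<noteq> i" "x $ k \<bullet> a = 0" "x $ i \<bullet> a = 0" "x $ j \<bullet> a = det x" for i j k a
    using body[OF that(4) that(1-3)] that(5,6) by simp
  have "\<Omega> \<bullet> \<Omega> = U' (x $ 1 \<bullet> x $ 2) * U' (x $ 2 \<bullet> x $ 3) * U' (x $ 3 \<bullet> x $ 1) *
      (m 3 / (U' (x $ 1 \<bullet> x $ 2))\<^sup>2 + m 1 / (U' (x $ 2 \<bullet> x $ 3))\<^sup>2 + m 2 / (U' (x $ 3 \<bullet> x $ 1))\<^sup>2)"
  proof (rule squared_norm_from_relations[OF det _ _ _ _ _ _ cramer_inner_3])
    show "m 1 \<noteq> 0" "m 2 \<noteq> 0" "m 3 \<noteq> 0"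
      using assms(4) by (metis less_irrefl)+
    show "U' (x $ 1 \<bullet> x $ 2) \<noteq> 0" "U' (x $ 2 \<bullet> x $ 3) \<noteq> 0" "U' (x $ 3 \<bullet> x $ 1) \<noteq> 0"
      by (simp_all add: U'_nz)
    show "(\<Omega> \<bullet> x $ 1) * (\<Omega> \<bullet> cross3 (x $ 3) (x $ 1)) = m 2 * U' (x $ 1 \<bullet> x $ 2) * det x"
      by (rule e[of 3]) (simp_all add: det_eq dot_cross_self)
    show "(\<Omega> \<bullet> x $ 2) * (\<Omega> \<bullet> cross3 (x $ 2) (x $ 3)) = m 1 * U' (x $ 1 \<bullet> x $ 2) * det x"
      \<comment> \<open>The relation for body 2 carries the inner product with body 2 first, so the
        arguments are swapped.\<close>
      unfolding inner_commute[of "x $ 1" "x $ 2"]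
      by (rule e[of 3]) (simp_all add: det_eq dot_cross_self)
    show "(\<Omega> \<bullet> x $ 2) * (\<Omega> \<bullet> cross3 (x $ 1) (x $ 2)) = m 3 * U' (x $ 2 \<bullet> x $ 3) * det x"
      by (rule e[of 1]) (simp_all add: det_eq dot_cross_self)
    show "(\<Omega> \<bullet> x $ 3) * (\<Omega> \<bullet> cross3 (x $ 3) (x $ 1)) = m 2 * U' (x $ 2 \<bullet> x $ 3) * det x"
      unfolding inner_commute[of "x $ 2" "x $ 3"]
      by (rule e[of 1]) (simp_all add: det_eq dot_cross_self)
    show "(\<Omega> \<bullet> x $ 3) * (\<Omega> \<bullet> cross3 (x $ 2) (x $ 3)) = m 1 * U' (x $ 3 \<bullet> x $ 1) * det x"
      by (rule e[of 2]) (simp_all add: det_eq dot_cross_self)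
    show "(\<Omega> \<bullet> x $ 1) * (\<Omega> \<bullet> cross3 (x $ 1) (x $ 2)) = m 3 * U' (x $ 3 \<bullet> x $ 1) * det x"
      unfolding inner_commute[of "x $ 3" "x $ 1"]
      by (rule e[of 2]) (simp_all add: det_eq dot_cross_self)
  qed
  then show ?thesis
    by (simp add: power2_norm_eq_inner cos_eq algebra_simps)
qed

end
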